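(* Let $t$ be an arbitrary monotone, strict aggregation function with $m$ arguments. Let $\mathbf{D}$ be the class of all databases (with $m$ sorted lists). Let $\mathbf{A}$ be the class of all algorithms that correctly find the top $k$ answers for $t$ for every database and that do not make wild guesses. There is no deterministic algorithm that is instance optimal over $\mathbf{A}$ and $\mathbf{D}$ with optimality ratio less than $m+m(m-1)c_R/c_S$.
   Context: Setting: fix positive integers $m$ and $k$ (treated as constants). A database consists of a finite set of $N\ge k$ objects; each object $R$ has $m$ grades (fields) $x_1,\dots,x_m\in[0,1]$. It is presented as $m$ sorted lists $L_1,\dots,L_m$ of length $N$; list $L_i$ contains one entry $(R,x_i)$ for each object $R$, in descending order of $x_i$ (the order among ties is part of the database). An aggregation function is a fixed function $t:[0,1]^m\to[0,\infty)$; the overall grade of $R$ is $t(R)=t(x_1,\dots,x_m)$. $t$ is monotone if $t(x_1,\dots,x_m)\le t(x_1',\dots,x_m')$ whenever $x_i\le x_i'$ for every $i$. $t$ is strict if $t(x_1,\dots,x_m)=1$ holds precisely when $x_i=1$ for every $i$. The top $k$ answers are $k$ objects with the highest overall grades (ties broken arbitrarily), each along with its overall grade. Access and cost: an algorithm obtains information about the database only by sorted access (reading the next entry of some list, proceeding sequentially from the top) and random access (requesting the grade of a given object in a given list, obtained in one step). Internal computation is free. With $s$ sorted and $r$ random accesses the middleware cost is $s c_S+r c_R$, where $c_S,c_R>0$ are fixed constants; $cost(\mathcal A,\mathcal D)$ is the middleware cost of algorithm $\mathcal A$ on database $\mathcal D$. An algorithm makes wild guesses if it does random access to find the grade of some object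 in some list before having seen that object under sorted access. Instance optimality: algorithm $\mathcal B$ is instance optimal over $\mathbf A$ and $\mathbf D$ with optimality ratio $c$ if $\mathcal B\in\mathbf A$ and there is a constant $c'$ such that $cost(\mathcal B,\mathcal D)\le c\cdot cost(\mathcal A,\mathcal D)+c'$ for every $\mathcal A\in\mathbf A$ and $\mathcal D\in\mathbf D$.
   Formalization: The formal theorem assumes m ≥ 2; for m = 1 the claim is false, since reading the first k entries of the only list always costs k·c_S and is thus instance optimal with ratio 0, below the bound 1. *)

theory Defs
  imports Complex_Main "HOL-Library.Cardinality" "HOL-Library.Infinite_Typeclass"
begin

section \<open>Databases\<close>

text \<open>
  The \<open>m\<close> lists are indexed by a finite type \<^typ>\<open>'m\<close>, so \<open>m = CARD('m)\<close>, and a tuple of grades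
  is a function from \<^typ>\<open>'m\<close> to the reals.  Object names come from an arbitrary type \<^typ>\<open>'a\<close>,
  which the theorem takes to be infinite so that databases of every finite size exist.  The lists,
  including the order of tied entries, are the database itself.
\<close>

type_synonym ('a, 'm) database = "'m \<Rightarrow> ('a \<times> real) list"

definition objects :: "('a, 'm) database \<Rightarrow> 'a set" where
  "objects D = (\<Union>i. fst ` set (D i))"

definition databases :: "nat \<Rightarrow> ('a, 'm::finite) database set" where
  "databases k = {D. k \<le> card (objects D) \<and>
     (\<forall>i. fst ` set (D i) = objects D \<and> distinct (map fst (D i)) \<and>
          snd ` set (D i) \<subseteq> {0..1} \<and> sorted_wrt (\<ge>) (map snd (D i)))}"

definition grade :: "('a, 'm) database \<Rightarrow> 'a \<Rightarrow> 'm \<Rightarrow> real" where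
  "grade D R i = the (map_of (D i) R)"

section \<open>Aggregation functions\<close>

definition unit_cube :: "('m \<Rightarrow> real) set" where
  "unit_cube = {x. \<forall>i. x i \<in> {0..1}}"

definition aggregation_function :: "(('m \<Rightarrow> real) \<Rightarrow> real) \<Rightarrow> bool" where
  "aggregation_function t \<longleftrightarrow> (\<forall>x\<in>unit_cube. 0 \<le> t x)"

definition monotone_agg :: "(('m \<Rightarrow> real) \<Rightarrow> real) \<Rightarrow> bool" where
  "monotone_agg t \<longleftrightarrow> (\<forall>x\<in>unit_cube. \<forall>x'\<in>unit_cube. (\<forall>i. x i \<le> x' i) \<longrightarrow> t x \<le> t x')"

definition strict_agg :: "(('m \<Rightarrow> real) \<Rightarrow> real) \<Rightarrow> bool" where
  "strict_agg t \<longleftrightarrow> (\<forall>x\<in>unit_cube. t x = 1 \<longleftrightarrow> (\<forall>i. x i = 1))"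

definition overall :: "(('m \<Rightarrow> real) \<Rightarrow> real) \<Rightarrow> ('a, 'm) database \<Rightarrow> 'a \<Rightarrow> real" where
  "overall t D R = t (grade D R)"

text \<open>Ties may be broken arbitrarily, so a database can have several correct top-\<open>k\<close> answers.\<close>

definition top_k_answer ::
  "(('m \<Rightarrow> real) \<Rightarrow> real) \<Rightarrow> nat \<Rightarrow> ('a, 'm) database \<Rightarrow> ('a \<times> real) set \<Rightarrow> bool" where
  "top_k_answer t k D Y \<longleftrightarrow>
     (\<exists>S. S \<subseteq> objects D \<and> card S = k \<and>
          (\<forall>R\<in>S. \<forall>R'\<in>objects D - S. overall t D R' \<le> overall t D R) \<and>
          Y = (\<lambda>R. (R, overall t D R)) ` S)"

section \<open>Algorithms\<close>

text \<open>
  A deterministic algorithm chooses its next move from the transcript of all accesses made so far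
  and their results.  The transcript is its only source of information (in particular the number of
  objects is not given in advance), and since internal computation is free, the choice can be any
  function of it.
\<close>

datatype ('a, 'm) access = Sorted 'm | Random 'a 'm

type_synonym ('a, 'm) transcript = "(('a, 'm) access \<times> ('a \<times> real) option) list"

datatype ('a, 'm) move = Access "('a, 'm) access" | Halt "('a \<times> real) set"

type_synonym ('a, 'm) algorithm = "('a, 'm) transcript \<Rightarrow> ('a, 'm) move"

definition sorted_count :: "('a, 'm) transcript \<Rightarrow> 'm \<Rightarrow> nat" where
  "sorted_count h i = length (filter (\<lambda>e. fst e = Sorted i) h)"

text \<open>
  The result \<^const>\<open>None\<close> signals that a list is exhausted, or that the requested object is not in
  the database.
\<close>

fun answer ::
  "('a, 'm) database \<Rightarrow> ('a, 'm) transcript \<Rightarrow> ('a, 'm) access \<Rightarrow> ('a \<times> real) option" where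
  "answer D h (Sorted i) =
     (let d = sorted_count h i in if d < length (D i) then Some (D i ! d) else None)"
| "answer D h (Random R i) = map_option (\<lambda>x. (R, x)) (map_of (D i) R)"

inductive reachable ::
  "('a, 'm) algorithm \<Rightarrow> ('a, 'm) database \<Rightarrow> ('a, 'm) transcript \<Rightarrow> bool"
  for A D where
  start: "reachable A D []"
| step: "reachable A D h \<Longrightarrow> A h = Access a \<Longrightarrow> reachable A D (h @ [(a, answer D h a)])"

definition halts_with ::
  "('a, 'm) algorithm \<Rightarrow> ('a, 'm) database \<Rightarrow> ('a, 'm) transcript \<Rightarrow> ('a \<times> real) set \<Rightarrow> bool" where
  "halts_with A D h Y \<longleftrightarrow> reachable A D h \<and> A h = Halt Y"

definition correct :: "(('m::finite \<Rightarrow> real) \<Rightarrow> real) \<Rightarrow> nat \<Rightarrow> ('a, 'm) algorithm \<Rightarrow> bool" where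
  "correct t k A \<longleftrightarrow> (\<forall>D\<in>databases k. \<exists>h Y. halts_with A D h Y \<and> top_k_answer t k D Y)"

definition seen :: "('a, 'm) transcript \<Rightarrow> 'a set" where
  "seen h = {R. \<exists>i x. (Sorted i, Some (R, x)) \<in> set h}"

definition no_wild_guesses :: "nat \<Rightarrow> ('a, 'm::finite) algorithm \<Rightarrow> bool" where
  "no_wild_guesses k A \<longleftrightarrow>
     (\<forall>D\<in>databases k. \<forall>h R i. reachable A D h \<and> A h = Access (Random R i) \<longrightarrow> R \<in> seen h)"

definition algorithms ::
  "(('m::finite \<Rightarrow> real) \<Rightarrow> real) \<Rightarrow> nat \<Rightarrow> ('a, 'm) algorithm set" where
  "algorithms t k = {A. correct t k A \<and> no_wild_guesses k A}"

section \<open>Cost and instance optimality\<close>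

fun access_cost :: "real \<Rightarrow> real \<Rightarrow> ('a, 'm) access \<Rightarrow> real" where
  "access_cost cS cR (Sorted i) = cS"
| "access_cost cS cR (Random R i) = cR"

text \<open>
  A run is deterministic, so it has at most one halting transcript; the cost is meaningful only if
  there is one, as is always the case for correct algorithms.
\<close>

definition final_transcript ::
  "('a, 'm) algorithm \<Rightarrow> ('a, 'm) database \<Rightarrow> ('a, 'm) transcript" where
  "final_transcript A D = (THE h. \<exists>Y. halts_with A D h Y)"

definition cost ::
  "real \<Rightarrow> real \<Rightarrow> ('a, 'm) algorithm \<Rightarrow> ('a, 'm) database \<Rightarrow> real" where
  "cost cS cR A D = (\<Sum>e\<leftarrow>final_transcript A D. access_cost cS cR (fst e))"

definition instance_optimal ::
  "real \<Rightarrow> real \<Rightarrow> ('a, 'm) algorithm set \<Rightarrow> ('a, 'm) database set \<Rightarrow> real \<Rightarrow>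
   ('a, 'm) algorithm \<Rightarrow> bool" where
  "instance_optimal cS cR \<A> \<D> c B \<longleftrightarrow>
     B \<in> \<A> \<and> (\<exists>c'. \<forall>A\<in>\<A>. \<forall>D\<in>\<D>. cost cS cR B D \<le> c * cost cS cR A D + c')"

end

theory Submission
  imports Defs "HOL-Library.Countable"
begin

text \<open>
  Against a deterministic algorithm \<open>B\<close>, an adversary puts \<open>d\<close> candidates of grade 1 near the top of
  each of the \<open>m\<close> lists.  Exactly one candidate, the winner, has full grades (apart from \<open>k - 1\<close>
  objects with full grades at the very top); any other one has a single grade 0.  Its position is
  chosen adaptively: it is found only by the last of the \<open>m - 1\<close> random accesses to this candidate,
  and the winner is the last candidate to be settled.  Since a candidate must be seen before it is
  accessed at random, \<open>B\<close> pays \<open>c\<^sub>S + (m - 1) c\<^sub>R\<close> for each of \<open>m d - 1\<close> candidates.  An algorithm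
  that gambles on the winner reads its list to depth \<open>d\<close>, checks only the \<open>k\<close> objects with full
  grades, and pays \<open>d c\<^sub>S + O(1)\<close>.  The ratio tends to \<open>m + m (m - 1) c\<^sub>R / c\<^sub>S\<close>.
\<close>

section \<open>Transcripts\<close>

definition valid :: "('a, 'm) database \<Rightarrow> ('a, 'm) transcript \<Rightarrow> bool" where
  "valid D h \<longleftrightarrow> (\<forall>n<length h. snd (h ! n) = answer D (take n h) (fst (h ! n)))"

lemma valid_Nil [simp]: "valid D []"
  by (simp add: valid_def)

lemma valid_snoc [simp]:
  "valid D (h @ [e]) \<longleftrightarrow> valid D h \<and> snd e = answer D h (fst e)"
  by (auto simp: valid_def nth_append less_Suc_eq)

lemma reachable_snoc_iff:
  "reachable A D (h @ [e]) \<longleftrightarrow>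
     reachable A D h \<and> A h = Access (fst e) \<and> snd e = answer D h (fst e)"
proof
  assume "reachable A D (h @ [e])"
  then show "reachable A D h \<and> A h = Access (fst e) \<and> snd e = answer D h (fst e)"
    by (cases rule: reachable.cases) auto
next
  assume "reachable A D h \<and> A h = Access (fst e) \<and> snd e = answer D h (fst e)"
  then show "reachable A D (h @ [e])"
    using reachable.step[of A D h "fst e"] by (metis prod.collapse)
qed

lemma reachable_valid: "reachable A D h \<Longrightarrow> valid D h"
  by (induction rule: reachable.induct) auto

lemma reachable_transfer: "reachable A D h \<Longrightarrow> valid D' h \<Longrightarrow> reachable A D' h"
  by (induction h rule: rev_induct) (auto simp: reachable_snoc_iff intro: reachable.start)

lemma reachable_take: "reachable A D h \<Longrightarrow> reachable A D (take n h)"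
  by (induction h rule: rev_induct) (auto simp: reachable_snoc_iff take_Cons' not_le)

lemma reachable_unique:
  "reachable A D h \<Longrightarrow> reachable A D h' \<Longrightarrow> length h = length h' \<Longrightarrow> h = h'"
proof (induction h arbitrary: h' rule: rev_induct)
  case (snoc e h)
  then obtain g f where h': "h' = g @ [f]"
    by (metis length_0_conv rev_exhaust snoc_eq_iff_butlast)
  then have "h = g"
    using snoc by (intro snoc.IH) (simp_all add: reachable_snoc_iff)
  then show ?case
    using snoc.prems(1,2) by (simp add: h' reachable_snoc_iff prod_eq_iff)
qed auto

lemma halts_with_prefix:
  assumes "halts_with A D h Y" and "reachable A D h'"
  shows "take (length h') h = h'"
proof -
  have "length h' \<le> length h"
  proof (rule ccontr)
    assume less: "\<not> length h' \<le> length h"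
    then have "reachable A D (take (length h) h' @ [h' ! length h])"
      using reachable_take[OF assms(2), of "Suc (length h)"] by (simp add: take_Suc_conv_app_nth)
    moreover have "take (length h) h' = h"
      using reachable_unique[OF reachable_take[OF assms(2)]] assms(1) less
      by (auto simp: halts_with_def)
    ultimately show False
      using assms(1) by (simp add: reachable_snoc_iff halts_with_def)
  qed
  then show ?thesis
    using assms by (intro reachable_unique[OF reachable_take]) (auto simp: halts_with_def)
qed

lemma halts_with_length_le:
  "halts_with A D h Y \<Longrightarrow> reachable A D h' \<Longrightarrow> length h' \<le> length h"
  by (metis halts_with_prefix length_take min.cobounded1)

lemma final_transcript_eq:
  assumes "halts_with A D h Y"
  shows "final_transcript A D = h"
  unfolding final_transcript_def
proof (rule the_equality)
  show "\<exists>Y. halts_with A D h Y"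
    using assms by blast
next
  fix g
  assume "\<exists>Y. halts_with A D g Y"
  then show "g = h"
    using assms halts_with_length_le
    by (metis halts_with_def le_antisym reachable_unique)
qed

lemma sorted_count_simps [simp]:
  "sorted_count [] i = 0"
  "sorted_count (h @ g) i = sorted_count h i + sorted_count g i"
  "sorted_count [e] i = (if fst e = Sorted i then 1 else 0)"
  by (auto simp: sorted_count_def)

lemma sorted_count_take_less:
  assumes "n < length h" and "fst (h ! n) = Sorted i"
  shows "sorted_count (take n h) i < sorted_count h i"
proof -
  have "h = take n h @ [h ! n] @ drop (Suc n) h"
    using assms(1) by (simp add: id_take_nth_drop)
  then have "sorted_count h i = sorted_count (take n h) i + 1 + sorted_count (drop (Suc n) h) i"
    using assms(2) sorted_count_simps by (metis (no_types, lifting) add.assoc)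
  then show ?thesis by simp
qed

lemma valid_sorted_access:
  assumes "valid D h" and "(Sorted i, Some p) \<in> set h"
  shows "\<exists>n<sorted_count h i. n < length (D i) \<and> D i ! n = p"
proof -
  obtain n where n: "n < length h" "h ! n = (Sorted i, Some p)"
    using assms(2) by (auto simp: in_set_conv_nth)
  then have "answer D (take n h) (Sorted i) = Some p"
    using assms(1) by (metis valid_def fst_conv snd_conv)
  then show ?thesis
    using sorted_count_take_less[OF n(1), of i] n(2) by (auto simp: Let_def split: if_splits)
qed

lemma valid_random_access:
  assumes "valid D h" and "(Random R i, Some (R, x)) \<in> set h"
  shows "map_of (D i) R = Some x"
proof -
  obtain n where n: "n < length h" "h ! n = (Random R i, Some (R, x))"
    using assms(2) by (auto simp: in_set_conv_nth)
  then have "answer D (take n h) (Random R i) = Some (R, x)"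
    using assms(1) by (metis valid_def fst_conv snd_conv)
  then show ?thesis by auto
qed

lemma valid_exhausted:
  assumes "valid D h" and "length (D i) < sorted_count h i"
  shows "(Sorted i, None) \<in> set h"
  using assms
proof (induction h rule: rev_induct)
  case (snoc e h)
  show ?case
  proof (cases "length (D i) < sorted_count h i")
    case False
    then have "fst e = Sorted i" "sorted_count h i = length (D i)"
      using snoc.prems by (auto split: if_splits)
    then have "e = (Sorted i, None)"
      using snoc.prems by (simp add: prod_eq_iff)
    then show ?thesis by simp
  qed (use snoc in auto)
qed simp

definition database_of :: "('a, 'm) transcript \<Rightarrow> ('a, 'm) database" where
  "database_of h i = map (the \<circ> snd) (filter (\<lambda>e. fst e = Sorted i \<and> snd e \<noteq> None) h)"

lemma database_of_take: "valid D h \<Longrightarrow> database_of h i = take (sorted_count h i) (D i)"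
  by (induction h rule: rev_induct)
    (auto simp: database_of_def Let_def take_Suc_conv_app_nth simp del: not_None_eq split: if_splits)

lemma database_of_eq:
  assumes "valid D h" and "\<And>i. (Sorted i, None) \<in> set h"
  shows "database_of h = D"
proof
  fix i
  obtain n where n: "n < length h" "h ! n = (Sorted i, None)"
    using assms(2)[of i] by (auto simp: in_set_conv_nth)
  then have "answer D (take n h) (Sorted i) = None"
    using assms(1) by (metis valid_def fst_conv snd_conv)
  then have "length (D i) \<le> sorted_count h i"
    using sorted_count_take_less[OF n(1), of i] n(2) by (auto simp: Let_def split: if_splits)
  then show "database_of h i = D i"
    using database_of_take[OF assms(1), of i] by simp
qed

section \<open>Algorithms that gamble on an expected transcript\<close>

definition scripted ::
  "(('m::finite \<Rightarrow> real) \<Rightarrow> real) \<Rightarrow> nat \<Rightarrow> ('a, 'm) transcript \<Rightarrow> ('a \<times> real) set \<Rightarrow> ('a, 'm) algorithm"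
  where
  "scripted t k E Y h =
     (if length h < length E \<and> h = take (length h) E then Access (fst (E ! length h))
      else if h = E then Halt Y
      else if \<exists>i. (Sorted i, None) \<notin> set h then Access (Sorted (SOME i. (Sorted i, None) \<notin> set h))
      else Halt (SOME Y. top_k_answer t k (database_of h) Y))"

lemma scripted_length_le:
  assumes "reachable (scripted t k E Y) D h"
  shows "length h \<le> length E + (\<Sum>i\<in>UNIV. min (sorted_count h i) (Suc (length (D i))))"
  using assms
proof (induction rule: reachable.induct)
  case (step h a)
  let ?s = "\<lambda>h i. min (sorted_count h i) (Suc (length (D i)))"
  let ?h = "h @ [(a, answer D h a)]"
  have mono: "?s h i \<le> ?s ?h i" for i
    by auto
  show ?case
  proof (cases "length h < length E \<and> h = take (length h) E")
    case False
    then have ex: "\<exists>i. (Sorted i, None) \<notin> set h"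
      and a: "a = Sorted (SOME i. (Sorted i, None) \<notin> set h)"
      using step.hyps(2) by (auto simp: scripted_def split: if_splits)
    define i where "i = (SOME i. (Sorted i, None) \<notin> set h)"
    have "(Sorted i, None) \<notin> set h"
      unfolding i_def using ex by (rule someI_ex)
    then have "sorted_count h i \<le> length (D i)"
      using valid_exhausted[OF reachable_valid[OF step.hyps(1)], of i] by (meson not_le)
    then have "?s h i < ?s ?h i"
      using a by (simp add: i_def)
    then have "(\<Sum>i\<in>UNIV. ?s h i) < (\<Sum>i\<in>UNIV. ?s ?h i)"
      using mono by (intro sum_strict_mono_ex1) auto
    then show ?thesis
      using step.IH by simp
  qed simp
qed simp

lemma halts_if_length_bounded:
  assumes "\<And>h. reachable A D h \<Longrightarrow> length h \<le> b"
  shows "\<exists>h Y. halts_with A D h Y"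
proof -
  have "\<exists>h. reachable A D h \<and> (\<forall>g. reachable A D g \<longrightarrow> length g \<le> length h)"
    using assms by (intro ex_has_greatest_nat[where b = "Suc b"])
      (auto intro: reachable.start simp: assms le_imp_less_Suc)
  then obtain h where h: "reachable A D h" "\<And>g. reachable A D g \<Longrightarrow> length g \<le> length h"
    by blast
  show ?thesis
  proof (cases "A h")
    case (Access a)
    then show ?thesis
      using h(2)[OF reachable.step[OF h(1) Access]] by simp
  qed (use h in \<open>auto simp: halts_with_def\<close>)
qed

lemma scripted_in_algorithms:
  fixes E :: "('a, 'm::finite) transcript"
  assumes ex: "\<And>D :: ('a, 'm) database. D \<in> databases k \<Longrightarrow> \<exists>Y. top_k_answer t k D Y"
    and Y: "\<And>D. D \<in> databases k \<Longrightarrow> valid D E \<Longrightarrow> top_k_answer t k D Y"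
    and seen: "\<And>n R i. n < length E \<Longrightarrow> fst (E ! n) = Random R i \<Longrightarrow> R \<in> seen (take n E)"
  shows "scripted t k E Y \<in> algorithms t k"
proof -
  let ?A = "scripted t k E Y"
  have "\<exists>h Y. halts_with ?A D h Y \<and> top_k_answer t k D Y" if D: "D \<in> databases k" for D
  proof -
    have "length h \<le> length E + (\<Sum>i\<in>UNIV. Suc (length (D i)))" if "reachable ?A D h" for h
      using scripted_length_le[OF that] by (rule order_trans) (intro add_left_mono sum_mono, simp)
    from halts_if_length_bounded[OF this] obtain h Z where h: "halts_with ?A D h Z"
      by blast
    then have v: "valid D h" and Z: "?A h = Halt Z"
      by (auto simp: halts_with_def dest: reachable_valid)
    have "top_k_answer t k D Z"
    proof (cases "h = E")
      case True
      then show ?thesis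
        using Z Y[OF D] v by (simp add: scripted_def)
    next
      case False
      then have "Z = (SOME Y. top_k_answer t k (database_of h) Y)"
        and none: "\<And>i. (Sorted i, None) \<in> set h"
        using Z by (auto simp: scripted_def split: if_splits)
      then show ?thesis
        using database_of_eq[OF v none] someI_ex[OF ex[OF D]] by simp
    qed
    then show ?thesis
      using h by blast
  qed
  moreover have "R \<in> seen h" if "?A h = Access (Random R i)" for h R i
    using that seen[of "length h" R i] by (auto simp: scripted_def split: if_splits)
  ultimately show ?thesis
    by (auto simp: algorithms_def correct_def no_wild_guesses_def)
qed

lemma scripted_cost:
  assumes "valid D E"
  shows "cost cS cR (scripted t k E Y) D = (\<Sum>e\<leftarrow>E. access_cost cS cR (fst e))"
proof -
  have "reachable (scripted t k E Y) D (take n E)" if "n \<le> length E" for n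
    using that
  proof (induction n)
    case (Suc n)
    then show ?case
      using assms
      by (auto simp: take_Suc_conv_app_nth reachable_snoc_iff scripted_def valid_def)
  qed (simp add: reachable.start)
  from this[of "length E"] have "halts_with (scripted t k E Y) D E Y"
    by (simp add: halts_with_def scripted_def)
  then show ?thesis
    by (simp add: cost_def final_transcript_eq)
qed

section \<open>Top answers when some objects have full grades\<close>

lemma grade_eqI: "map_of (D i) R = Some x \<Longrightarrow> grade D R i = x"
  by (simp add: grade_def)

lemma map_of_database:
  assumes "D \<in> databases k"
  shows "map_of (D i) R = Some x \<longleftrightarrow> (R, x) \<in> set (D i)"
  using assms by (simp add: databases_def map_of_eq_Some_iff)

lemma grade_in_unit_cube:
  assumes "D \<in> databases k" and "R \<in> objects D"
  shows "grade D R \<in> unit_cube"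
proof -
  have "grade D R i \<in> {0..1}" for i
  proof -
    have "R \<in> fst ` set (D i)"
      using assms by (simp add: databases_def)
    then obtain x where x: "(R, x) \<in> set (D i)"
      by force
    then have "grade D R i = x"
      using assms(1) by (intro grade_eqI) (simp add: map_of_database)
    then show ?thesis
      using x assms(1) by (force simp: databases_def)
  qed
  then show ?thesis
    by (simp add: unit_cube_def)
qed

lemma agg_le_1:
  assumes "monotone_agg t" and "strict_agg t" and "x \<in> unit_cube"
  shows "t x \<le> 1"
proof -
  have 1: "(\<lambda>_. 1) \<in> unit_cube"
    by (simp add: unit_cube_def)
  then have "t x \<le> t (\<lambda>_. 1)"
    using assms(1,3) unfolding monotone_agg_def by (auto simp: unit_cube_def)
  also have "t (\<lambda>_. 1) = 1"
    using assms(2) 1 unfolding strict_agg_def by blast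
  finally show ?thesis .
qed

lemma overall_full:
  assumes "strict_agg t" and "\<And>i. grade D R i = 1"
  shows "overall t D R = 1"
proof -
  have "grade D R = (\<lambda>_. 1)"
    using assms(2) by blast
  then show ?thesis
    using assms(1) by (simp add: overall_def strict_agg_def unit_cube_def)
qed

lemma overall_less_1:
  assumes "monotone_agg t" and "strict_agg t" and "D \<in> databases k" and "R \<in> objects D"
    and "grade D R i \<noteq> 1"
  shows "overall t D R < 1"
  using agg_le_1[OF assms(1,2) grade_in_unit_cube[OF assms(3,4)]] assms(2,5)
    grade_in_unit_cube[OF assms(3,4)]
  unfolding overall_def strict_agg_def by (metis order_le_less)

lemma top_k_answer_full:
  assumes "monotone_agg t" and "strict_agg t" and "D \<in> databases k"
    and "S \<subseteq> objects D" and "card S = k" and "\<And>R i. R \<in> S \<Longrightarrow> grade D R i = 1"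
  shows "top_k_answer t k D ((\<lambda>R. (R, 1)) ` S)"
  unfolding top_k_answer_def
proof (intro exI[of _ S] conjI ballI)
  have 1: "overall t D R = 1" if "R \<in> S" for R
    using assms(2,6) that by (intro overall_full) auto
  show "overall t D R' \<le> overall t D R" if "R \<in> S" "R' \<in> objects D - S" for R R'
    using that 1 agg_le_1[OF assms(1,2) grade_in_unit_cube[OF assms(3)]]
    by (simp add: overall_def)
  show "(\<lambda>R. (R, 1)) ` S = (\<lambda>R. (R, overall t D R)) ` S"
    using 1 by (intro image_cong) auto
qed (use assms in auto)

lemma top_k_answer_full_unique:
  assumes "monotone_agg t" and "strict_agg t" and "D \<in> databases k"
    and "S \<subseteq> objects D" and "card S = k" and "\<And>R i. R \<in> S \<Longrightarrow> grade D R i = 1"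
    and "\<And>R. R \<in> objects D - S \<Longrightarrow> \<exists>i. grade D R i \<noteq> 1"
    and "top_k_answer t k D Y"
  shows "fst ` Y = S"
proof -
  obtain T where T: "T \<subseteq> objects D" "card T = k"
      "\<And>R R'. R \<in> T \<Longrightarrow> R' \<in> objects D - T \<Longrightarrow> overall t D R' \<le> overall t D R"
      "Y = (\<lambda>R. (R, overall t D R)) ` T"
    using assms(8) unfolding top_k_answer_def by blast
  have fin: "finite (objects D)"
    by (simp add: objects_def)
  have "S \<subseteq> T"
  proof (rule ccontr)
    assume "\<not> S \<subseteq> T"
    then obtain R where R: "R \<in> S" "R \<notin> T"
      by blast
    then have "\<not> T \<subseteq> S"
      using card_subset_eq[of S T] finite_subset[OF assms(4) fin] T(2) assms(5) by auto
    then obtain R' where R': "R' \<in> T" "R' \<notin> S"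
      by blast
    then obtain i where "grade D R' i \<noteq> 1"
      using assms(7) T(1) by blast
    then have "overall t D R' < 1"
      using R' T(1) by (intro overall_less_1[OF assms(1-3)]) auto
    moreover have "overall t D R = 1"
      using assms(2,6) R(1) by (intro overall_full) auto
    ultimately show False
      using T(3)[OF R'(1), of R] R assms(4) by auto
  qed
  then have "T = S"
    using card_subset_eq[OF finite_subset[OF T(1) fin]] T(2) assms(5) by auto
  then show ?thesis
    using T(4) by (simp add: image_image)
qed

section \<open>The adversary\<close>

text \<open>
  List \<open>j\<close> starts with \<open>W @ H j\<close>, all of grade 1.  The objects of \<open>W\<close> have full grades and
  account for \<open>k - 1\<close> of the answers.  The first \<open>d\<close> entries of \<open>H j\<close> are the candidates: the winner
  \<open>w\<close> is one of them, and any other candidate \<open>R\<close> has grade 1 except in the list \<open>z R\<close>, which must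
  not be the list where \<open>R\<close> is near the top.  The remaining entries of \<open>H j\<close> only keep the
  candidates of the other lists out of the reach of sorted access.
\<close>

locale adversary =
  fixes W :: "'a list" and H :: "'m::finite \<Rightarrow> 'a list" and d :: nat
  assumes distinct_W: "distinct W"
    and distinct_H: "distinct (H i)"
    and W_H: "set W \<inter> set (H i) = {}"
    and H_H: "i \<noteq> j \<Longrightarrow> set (H i) \<inter> set (H j) = {}"
    and d_le: "d \<le> length (H i)"
    and two: "2 \<le> CARD('m)"
begin

definition cand :: "'a set" where
  "cand = (\<Union>i. set (take d (H i)))"

definition objs :: "'a set" where
  "objs = set W \<union> (\<Union>i. set (H i))"

definition gr :: "('a \<Rightarrow> 'm) \<Rightarrow> 'a \<Rightarrow> 'a \<Rightarrow> 'm \<Rightarrow> real" where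
  "gr z w R j =
     (if R \<in> set W \<or> R \<in> set (H j) \<or> R \<in> cand \<and> (R = w \<or> z R \<noteq> j) then 1 else 0)"

definition rest :: "'m \<Rightarrow> 'a list" where
  "rest j = (SOME L. set L = objs - set (W @ H j) \<and> distinct L)"

definition order :: "('a \<Rightarrow> 'm) \<Rightarrow> 'a \<Rightarrow> 'm \<Rightarrow> 'a list" where
  "order z w j = (W @ H j) @ filter (\<lambda>R. gr z w R j = 1) (rest j) @
     filter (\<lambda>R. gr z w R j \<noteq> 1) (rest j)"

definition db :: "('a \<Rightarrow> 'm) \<Rightarrow> 'a \<Rightarrow> ('a, 'm) database" where
  "db z w j = map (\<lambda>R. (R, gr z w R j)) (order z w j)"

definition admissible :: "('a \<Rightarrow> 'm) \<Rightarrow> bool" where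
  "admissible z \<longleftrightarrow> (\<forall>R\<in>cand. R \<notin> set (H (z R)))"

lemma cand_not_W: "R \<in> cand \<Longrightarrow> R \<notin> set W"
  using W_H by (auto simp: cand_def dest: in_set_takeD)

lemma cand_subset_objs: "cand \<subseteq> objs"
  by (auto simp: cand_def objs_def dest: in_set_takeD)

lemma finite_cand: "finite cand"
  by (simp add: cand_def)

lemma other_list: "\<exists>j. j \<noteq> (i::'m)"
proof (rule ccontr)
  assume "\<not> ?thesis"
  then have "UNIV = {i}" by auto
  then show False
    using two by (metis One_nat_def Suc_1 card.empty card.insert empty_iff finite.emptyI not_less_eq_eq order_refl)
qed

lemma not_in_other: "R \<in> set (H i) \<Longrightarrow> i \<noteq> j \<Longrightarrow> R \<notin> set (H j)"
  using H_H by blast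

lemma rest: "set (rest j) = objs - set (W @ H j)" "distinct (rest j)"
proof -
  have "finite (objs - set (W @ H j))"
    by (simp add: objs_def)
  then have "\<exists>L. set L = objs - set (W @ H j) \<and> distinct L"
    by (rule finite_distinct_list)
  from someI_ex[OF this] show "set (rest j) = objs - set (W @ H j)" "distinct (rest j)"
    by (simp_all add: rest_def)
qed

lemma order: "set (order z w j) = objs" "distinct (order z w j)"
  using rest[of j] distinct_W distinct_H[of j] W_H[of j] by (auto simp: order_def objs_def)

lemma gr_order: "i < length W + length (H j) \<Longrightarrow> gr z w (order z w j ! i) j = 1"
  by (auto simp: order_def gr_def nth_append)

lemma db_nth:
  assumes "n < length W + length (H j)"
  shows "n < length (db z w j)" "db z w j ! n = ((W @ H j) ! n, 1)"
proof -
  show "n < length (db z w j)"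
    using assms by (simp add: db_def order_def)
  have "order z w j ! n = (W @ H j) ! n"
    using assms unfolding order_def by (subst nth_append) simp
  moreover have "db z w j ! n = (order z w j ! n, gr z w (order z w j ! n) j)"
    using \<open>n < length (db z w j)\<close> by (simp add: db_def)
  ultimately show "db z w j ! n = ((W @ H j) ! n, 1)"
    using gr_order[OF assms, of z w] by simp
qed

lemma map_of_db: "map_of (db z w j) R = (if R \<in> objs then Some (gr z w R j) else None)"
  by (simp add: db_def map_of_map_restrict order restrict_map_def)

lemma grade_db: "R \<in> objs \<Longrightarrow> grade (db z w) R j = gr z w R j"
  by (simp add: grade_eqI map_of_db)

lemma objects_db: "objects (db z w) = objs"
  by (simp add: objects_def db_def image_image order)

lemma sorted_db: "sorted_wrt (\<ge>) (map snd (db z w j))"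
proof -
  have const: "sorted_wrt (\<lambda>R R'. gr z w R' j \<le> gr z w R j) xs"
    if "\<And>R. R \<in> set xs \<Longrightarrow> gr z w R j = c" for xs c
    using that by (simp add: sorted_wrt_iff_nth_less)
  have gr_W: "gr z w R j = 1" if "R \<in> set W \<union> set (H j)" for R
    using that by (auto simp: gr_def)
  have gr_le: "gr z w R j \<le> 1" for R
    by (simp add: gr_def)
  have "gr z w R j = 0" if "gr z w R j \<noteq> 1" for R
    using that by (simp add: gr_def split: if_splits)
  then have "sorted_wrt (\<lambda>R R'. gr z w R' j \<le> gr z w R j) (filter (\<lambda>R. gr z w R j \<noteq> 1) (rest j))"
    by (intro const[where c = 0]) auto
  moreover have "sorted_wrt (\<lambda>R R'. gr z w R' j \<le> gr z w R j)
      ((W @ H j) @ filter (\<lambda>R. gr z w R j = 1) (rest j))"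
    using gr_W by (intro const[where c = 1]) auto
  ultimately have "sorted_wrt (\<lambda>R R'. gr z w R' j \<le> gr z w R j) (order z w j)"
    unfolding order_def append_assoc[symmetric] using gr_W gr_le
    by (subst sorted_wrt_append) auto
  then show ?thesis
    by (simp add: db_def sorted_wrt_map o_def)
qed

lemma winners:
  assumes "w \<in> cand"
  shows "insert w (set W) \<subseteq> objs" "card (insert w (set W)) = Suc (length W)"
  using assms cand_not_W[OF assms] cand_subset_objs distinct_W
  by (auto simp: objs_def distinct_card)

lemma db_in_databases:
  assumes "w \<in> cand"
  shows "db z w \<in> databases (Suc (length W))"
proof -
  have "finite objs"
    by (simp add: objs_def)
  then have "Suc (length W) \<le> card objs"
    using winners[OF assms] by (metis card_mono)
  moreover have "fst ` set (db z w i) = objs" "distinct (map fst (db z w i))"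
    "snd ` set (db z w i) \<subseteq> {0..1}" for i
    using order[of z w i] by (auto simp: db_def image_image o_def gr_def)
  ultimately show ?thesis
    using sorted_db by (simp add: databases_def objects_db)
qed

lemma db_answer_unique:
  assumes "monotone_agg t" and "strict_agg t" and "admissible z" and "w \<in> cand"
    and "top_k_answer t (Suc (length W)) (db z w) Y"
  shows "fst ` Y = insert w (set W)"
proof (rule top_k_answer_full_unique[OF assms(1,2) db_in_databases[OF assms(4)] _ _ _ _ assms(5)])
  show "grade (db z w) R i = 1" if "R \<in> insert w (set W)" for R i
    using that winners(1)[OF assms(4)] assms(4) by (auto simp: grade_db gr_def)
  show "\<exists>i. grade (db z w) R i \<noteq> 1" if R: "R \<in> objects (db z w) - insert w (set W)" for R
  proof -
    obtain i where i: "R \<in> set (H i)"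
      using R by (auto simp: objects_db objs_def)
    obtain j where "j \<noteq> i"
      using other_list by blast
    have "R \<notin> set (H j)"
      using i \<open>j \<noteq> i\<close> not_in_other by metis
    show ?thesis
    proof (cases "R \<in> cand")
      case True
      then show ?thesis
        using R assms(3) by (intro exI[of _ "z R"]) (auto simp: objects_db grade_db gr_def admissible_def)
    next
      case False
      then show ?thesis
        using R \<open>R \<notin> set (H j)\<close> by (intro exI[of _ j]) (auto simp: objects_db grade_db gr_def)
    qed
  qed
qed (use winners[OF assms(4)] in \<open>auto simp: objects_db\<close>)

definition agree ::
  "('a, 'm) access set \<Rightarrow> ('a \<Rightarrow> 'm) \<Rightarrow> 'a \<Rightarrow> ('a \<Rightarrow> 'm) \<Rightarrow> 'a \<Rightarrow> bool" where
  "agree X z w z' w' \<longleftrightarrow> (\<forall>R j. Random R j \<in> X \<longrightarrow> gr z w R j = gr z' w' R j)"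

lemma agree_refl [simp]: "agree X z w z w"
  by (simp add: agree_def)

lemma valid_agree:
  assumes v: "valid (db z w) h" and c: "\<And>j. sorted_count h j \<le> length W + length (H j)"
    and a: "agree (fst ` set h) z w z' w'"
  shows "valid (db z' w') h"
  unfolding valid_def
proof (intro allI impI)
  fix n
  assume n: "n < length h"
  have "answer (db z w) (take n h) (fst (h ! n)) = answer (db z' w') (take n h) (fst (h ! n))"
  proof (cases "fst (h ! n)")
    case (Sorted i)
    then have "sorted_count (take n h) i < length W + length (H i)"
      using sorted_count_take_less[OF n Sorted] c[of i] by linarith
    then show ?thesis
      using Sorted db_nth[of "sorted_count (take n h) i" i] by (simp add: Let_def)
  next
    case (Random R i)
    have "fst (h ! n) \<in> fst ` set h"
      using n by auto
    then have "gr z w R i = gr z' w' R i"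
      using a Random by (simp add: agree_def)
    then show ?thesis
      using Random by (simp add: map_of_db)
  qed
  then show "snd (h ! n) = answer (db z' w') (take n h) (fst (h ! n))"
    using v n by (simp add: valid_def)
qed

definition full :: "('a, 'm) access set \<Rightarrow> 'a \<Rightarrow> bool" where
  "full X R \<longleftrightarrow> (\<forall>j. R \<notin> set (H j) \<longrightarrow> Random R j \<in> X)"

lemma full_mono: "full X R \<Longrightarrow> X \<subseteq> Y \<Longrightarrow> full Y R"
  by (auto simp: full_def)

text \<open>
  A zero is revealed only by the last possible random access to its object, and the winner is the
  last candidate to be settled.
\<close>

definition stingy :: "('a, 'm) access set \<Rightarrow> ('a \<Rightarrow> 'm) \<Rightarrow> 'a \<Rightarrow> bool" where
  "stingy X z w \<longleftrightarrow> admissible z \<and> w \<in> cand \<and>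
     (\<forall>R\<in>cand - {w}. Random R (z R) \<in> X \<longrightarrow> full X R) \<and>
     (full X w \<longrightarrow> (\<forall>R\<in>cand. full X R))"

lemma stingyD:
  assumes "stingy X z w"
  shows "admissible z" "w \<in> cand"
    "\<And>R. R \<in> cand \<Longrightarrow> R \<noteq> w \<Longrightarrow> Random R (z R) \<in> X \<Longrightarrow> full X R"
    "\<And>R. full X w \<Longrightarrow> R \<in> cand \<Longrightarrow> full X R"
  using assms by (auto simp: stingy_def)

lemma stingy_move_winner:
  assumes X: "stingy X z w" and R: "R \<in> cand" "\<not> full X R" and j: "w \<notin> set (H j)" "Random w j \<notin> X"
  shows "admissible (z(w := j))" "agree X z w (z(w := j)) R"
proof -
  show "admissible (z(w := j))"
    using stingyD(1)[OF X] j(1) by (simp add: admissible_def)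
  show "agree X z w (z(w := j)) R"
  proof (cases "R = w")
    case False
    then have "Random R (z R) \<notin> X"
      using stingyD(3)[OF X R(1)] R(2) by blast
    then show ?thesis
      using False j(2) by (auto simp: agree_def gr_def)
  qed (auto simp: agree_def gr_def)
qed

lemma stingy_step:
  assumes X: "stingy X z w"
  shows "\<exists>z' w'. stingy (insert a X) z' w' \<and> agree X z w z' w'"
proof (cases "\<exists>R j. a = Random R j \<and> R \<in> cand \<and> R \<notin> set (H j) \<and> a \<notin> X")
  case False
  then have full_eq: "full (insert a X) R = full X R" if "R \<in> cand" for R
    using that by (auto simp: full_def)
  have "Random R (z R) \<in> X" if "R \<in> cand" "Random R (z R) \<in> insert a X" for R
    using that False stingyD(1)[OF X] by (auto simp: admissible_def)
  then have "stingy (insert a X) z w"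
    using X full_eq unfolding stingy_def by blast
  then show ?thesis
    using agree_refl by blast
next
  case True
  then obtain R j where a: "a = Random R j" "R \<in> cand" "R \<notin> set (H j)" "a \<notin> X"
    by blast
  let ?X = "insert a X"
  have full_other: "full ?X R' = full X R'" if "R' \<noteq> R" for R'
    using that a(1) by (auto simp: full_def)
  have mono: "full X R' \<Longrightarrow> full ?X R'" for R'
    by (rule full_mono) auto
  show ?thesis
  proof (cases "R = w")
    case w: True
    show ?thesis
    proof (cases "full ?X w \<and> (\<exists>R'\<in>cand. \<not> full ?X R')")
      case True
      then obtain R' where R': "R' \<in> cand" "\<not> full ?X R'" "R' \<noteq> w"
        by blast
      have nf: "\<not> full X R'"
        using R'(2) mono by blast
      have jX: "w \<notin> set (H j)" "Random w j \<notin> X"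
        using a w by auto
      note m = stingy_move_winner[OF X R'(1) nf jX]
      have "stingy ?X (z(w := j)) R'"
        unfolding stingy_def
      proof (intro conjI ballI impI)
        fix R''
        assume R'': "R'' \<in> cand - {R'}" "Random R'' ((z(w := j)) R'') \<in> ?X"
        show "full ?X R''"
        proof (cases "R'' = w")
          case False
          then have "Random R'' (z R'') \<in> X"
            using R'' a(1) w by simp
          then show ?thesis
            using stingyD(3)[OF X] R'' False mono by blast
        qed (use True in simp)
      next
        fix R''
        assume "full ?X R'"
        then show "full ?X R''"
          using R'(2) by simp
      qed (use m R' in auto)
      then show ?thesis
        using m(2) by blast
    next
      case False
      have "full ?X R'" if "R' \<in> cand - {w}" "Random R' (z R') \<in> ?X" for R'
        using that a(1) w stingyD(3)[OF X] mono by auto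
      then have "stingy ?X z w"
        using False X unfolding stingy_def by blast
      then show ?thesis
        using agree_refl by blast
    qed
  next
    case Rw: False
    have fw: "full ?X w \<Longrightarrow> R' \<in> cand \<Longrightarrow> full ?X R'" for R'
      using full_other[of w] Rw stingyD(4)[OF X] mono by blast
    show ?thesis
    proof (cases "z R = j \<and> \<not> full ?X R")
      case True
      then obtain j' where j': "R \<notin> set (H j')" "Random R j' \<notin> ?X"
        by (auto simp: full_def)
      let ?z = "z(R := j')"
      have "admissible ?z"
        using stingyD(1)[OF X] j'(1) by (simp add: admissible_def)
      moreover have "full ?X R'" if "R' \<in> cand - {w}" "Random R' (?z R') \<in> ?X" for R'
        using that a(1) j'(2) stingyD(3)[OF X, of R'] mono by (cases "R' = R") auto
      ultimately have "stingy ?X ?z w"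
        using fw stingyD(2)[OF X] unfolding stingy_def by blast
      moreover have "agree X z w ?z w"
        using a True j'(2) by (auto simp: agree_def gr_def)
      ultimately show ?thesis
        by blast
    next
      case False
      have "full ?X R'" if "R' \<in> cand - {w}" "Random R' (z R') \<in> ?X" for R'
        using that a(1) False stingyD(3)[OF X, of R'] mono by auto
      then have "stingy ?X z w"
        using fw stingyD(1,2)[OF X] unfolding stingy_def by blast
      then show ?thesis
        using agree_refl by blast
    qed
  qed
qed

lemma stingy_empty:
  assumes "0 < d"
  shows "\<exists>z w. stingy {} z w"
proof -
  define z where "z R = (SOME j. R \<notin> set (H j))" for R
  have nf: "\<exists>j. R \<notin> set (H j)" for R
    using not_in_other other_list by metis
  then have "R \<notin> set (H (z R))" for R
    unfolding z_def by (rule someI_ex)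
  then have "admissible z"
    by (simp add: admissible_def)
  define w where "w = hd (take d (H undefined))"
  have "take d (H undefined) \<noteq> []"
    using assms d_le[of undefined] by auto
  then have "w \<in> cand"
    unfolding cand_def w_def by (meson UNIV_I UN_I hd_in_set)
  then have "stingy {} z w"
    using \<open>admissible z\<close> nf by (auto simp: stingy_def full_def)
  then show ?thesis by blast
qed

lemma halting_stingy_run:
  assumes B: "correct t (Suc (length W)) B"
    and t: "monotone_agg t" "strict_agg t" and "0 < d"
    and count: "\<And>z w j. admissible z \<Longrightarrow> w \<in> cand \<Longrightarrow>
      sorted_count (final_transcript B (db z w)) j \<le> length W + length (H j)"
    and len: "\<And>z w. admissible z \<Longrightarrow> w \<in> cand \<Longrightarrow> length (final_transcript B (db z w)) \<le> b"
  shows "\<exists>z w h Y R0. admissible z \<and> w \<in> cand \<and> halts_with B (db z w) h Y \<and> R0 \<in> cand \<and>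
    (\<forall>R\<in>cand - {R0}. full (fst ` set h) R)"
proof -
  have halts: "\<exists>Y. halts_with B (db z w) (final_transcript B (db z w)) Y
      \<and> top_k_answer t (Suc (length W)) (db z w) Y" if "w \<in> cand" for z w
    using B db_in_databases[OF that, of z] final_transcript_eq unfolding correct_def by blast
  have prefix: "length h \<le> b \<and> (\<forall>j. sorted_count h j \<le> length W + length (H j))"
    if h: "reachable B (db z w) h" and zw: "admissible z" "w \<in> cand" for z w h
  proof -
    let ?f = "final_transcript B (db z w)"
    obtain Y where "halts_with B (db z w) ?f Y"
      using halts[OF zw(2)] by blast
    from halts_with_prefix[OF this h] have f: "?f = h @ drop (length h) ?f"
      by (metis append_take_drop_id)
    have "length h \<le> length ?f"
      by (subst f) simp
    moreover have "sorted_count h j \<le> sorted_count ?f j" for j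
      by (subst f) simp
    ultimately show ?thesis
      using len[OF zw] count[OF zw] le_trans by blast
  qed
  let ?P = "\<lambda>h. \<exists>z w. stingy (fst ` set h) z w \<and> reachable B (db z w) h"
  have "?P []"
    using stingy_empty[OF \<open>0 < d\<close>] by (auto intro: reachable.start)
  moreover have "length h < Suc b" if "?P h" for h
    using that prefix stingyD(1,2) less_Suc_eq_le by blast
  ultimately obtain h where h: "?P h" "\<And>g. ?P g \<Longrightarrow> length g \<le> length h"
    using ex_has_greatest_nat[of ?P "[]" length "Suc b"] by blast
  then obtain z w where zw: "stingy (fst ` set h) z w" and r: "reachable B (db z w) h"
    by blast
  let ?X = "fst ` set h"
  have other: "reachable B (db z' w') h" if "agree ?X z w z' w'" for z' w'
    using prefix[OF r stingyD(1,2)[OF zw]]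
    by (intro reachable_transfer[OF r] valid_agree[OF reachable_valid[OF r] _ that]) blast
  obtain Y where Y: "B h = Halt Y"
  proof (cases "B h")
    case (Access a)
    obtain z' w' where z': "stingy (insert a ?X) z' w'" "agree ?X z w z' w'"
      using stingy_step[OF zw] by blast
    have "?P (h @ [(a, answer (db z' w') h a)])"
      using z'(1) reachable.step[OF other[OF z'(2)] Access] by auto
    then show thesis
      using h(2) by fastforce
  qed
  have hw: "halts_with B (db z w) h Y"
    using r Y by (simp add: halts_with_def)
  have answer: "fst ` Y = insert w' (set W)"
    if hY: "halts_with B (db z' w') h Y" and z': "admissible z'" and w': "w' \<in> cand" for z' w'
  proof -
    have "final_transcript B (db z' w') = h"
      using hY by (rule final_transcript_eq)
    then obtain Y' where "halts_with B (db z' w') h Y'" "top_k_answer t (Suc (length W)) (db z' w') Y'"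
      using halts[OF w', of z'] by auto
    moreover have "Y' = Y"
      using calculation(1) Y by (simp add: halts_with_def)
    ultimately show ?thesis
      using db_answer_unique[OF t z' w'] by blast
  qed
  have "full ?X R" if R: "R \<in> cand - {w}" for R
  proof (rule ccontr)
    assume nf: "\<not> full ?X R"
    then have "\<not> full ?X w"
      using stingyD(4)[OF zw] R by blast
    then obtain j where j: "w \<notin> set (H j)" "Random w j \<notin> ?X"
      by (auto simp: full_def)
    from R have "R \<in> cand" by simp
    note m = stingy_move_winner[OF zw this nf j]
    have "halts_with B (db (z(w := j)) R) h Y"
      using other[OF m(2)] Y by (simp add: halts_with_def)
    then have "fst ` Y = insert R (set W)"
      using m(1) R by (intro answer) auto
    moreover have "fst ` Y = insert w (set W)"
      using hw stingyD(1,2)[OF zw] by (intro answer)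
    ultimately show False
      using R cand_not_W[of R] by auto
  qed
  then show ?thesis
    using hw stingyD(1,2)[OF zw] by blast
qed

end

section \<open>Costs\<close>

lemma sum_access_cost:
  "(\<Sum>e\<leftarrow>h. access_cost cS cR (fst e)) =
     cS * real (length (filter (\<lambda>e. \<exists>i. fst e = Sorted i) h)) +
     cR * real (length (filter (\<lambda>e. \<exists>R i. fst e = Random R i) h))"
proof (induction h)
  case (Cons e h)
  then show ?case
    by (cases "fst e") (simp_all add: algebra_simps)
qed simp

lemma sorted_count_cost:
  assumes "0 \<le> cS" and "0 \<le> cR"
  shows "cS * real (sorted_count h j) \<le> (\<Sum>e\<leftarrow>h. access_cost cS cR (fst e))"
proof -
  have "sorted_count h j \<le> length (filter (\<lambda>e. \<exists>i. fst e = Sorted i) h)"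
    unfolding sorted_count_def by (induction h) auto
  then show ?thesis
    unfolding sum_access_cost using assms
    by (intro add_increasing2 mult_left_mono) auto
qed

lemma length_cost: "min cS cR * real (length h) \<le> (\<Sum>e\<leftarrow>h. access_cost cS cR (fst e))"
proof (induction h)
  case (Cons e h)
  have "min cS cR \<le> access_cost cS cR (fst e)"
    by (cases "fst e") auto
  with Cons show ?case
    by (simp add: algebra_simps)
qed simp

lemma card_seen_le: "card (seen h) \<le> length (filter (\<lambda>e. \<exists>i. fst e = Sorted i) h)"
proof -
  let ?F = "filter (\<lambda>e. \<exists>i. fst e = Sorted i) h"
  have "seen h \<subseteq> (fst \<circ> the \<circ> snd) ` set ?F"
    by (force simp: seen_def)
  then have "card (seen h) \<le> card (set ?F)"
    by (meson card_image_le card_mono finite_imageI finite_set le_trans)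
  also have "\<dots> \<le> length ?F"
    by (rule card_length)
  finally show ?thesis .
qed

lemma finite_seen: "finite (seen h)"
proof -
  have "seen h \<subseteq> (fst \<circ> the \<circ> snd) ` set h"
    by (force simp: seen_def)
  then show ?thesis
    by (rule finite_subset) simp
qed

lemma card_random_le:
  "card {(R, j). Random R j \<in> fst ` set h} \<le> length (filter (\<lambda>e. \<exists>R i. fst e = Random R i) h)"
    (is "card ?S \<le> length ?F")
  and finite_random: "finite {(R, j). Random R j \<in> fst ` set h}"
proof -
  have sub: "?S \<subseteq> (\<lambda>e. case fst e of Sorted _ \<Rightarrow> undefined | Random R j \<Rightarrow> (R, j)) ` set ?F"
    by (force simp: image_iff)
  then show "finite ?S"
    by (rule finite_subset) simp
  from sub have "card ?S \<le> card (set ?F)"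
    by (meson card_image_le card_mono finite_imageI finite_set le_trans)
  also have "\<dots> \<le> length ?F"
    by (rule card_length)
  finally show "card ?S \<le> length ?F" .
qed

lemma random_access_seen:
  assumes "no_wild_guesses k A" and "D \<in> databases k" and r: "reachable A D h"
    and "Random R j \<in> fst ` set h"
  shows "R \<in> seen h"
proof -
  obtain n where n: "n < length h" "fst (h ! n) = Random R j"
    using assms(4) by (auto simp: in_set_conv_nth)
  have "reachable A D (take n h @ [h ! n])"
    using reachable_take[OF r, of "Suc n"] n(1) by (simp add: take_Suc_conv_app_nth)
  then have "R \<in> seen (take n h)"
    using assms(1,2) n(2) by (auto simp: reachable_snoc_iff no_wild_guesses_def)
  then show ?thesis
    by (auto simp: seen_def dest: in_set_takeD)
qed

lemma valid_append_random:
  assumes "valid D h" and "\<And>R j. (R, j) \<in> set ps \<Longrightarrow> map_of (D j) R = Some 1"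
  shows "valid D (h @ map (\<lambda>(R, j). (Random R j, Some (R, 1))) ps)"
  using assms(2)
proof (induction ps rule: rev_induct)
  case (snoc p ps)
  then have "valid D (h @ map (\<lambda>(R, j). (Random R j, Some (R, 1))) ps)"
    by simp
  moreover have "map_of (D (snd p)) (fst p) = Some 1"
    by (rule snoc.prems) simp
  ultimately show ?case
    unfolding map_append append_assoc[symmetric] list.map valid_snoc by (cases p) simp
qed (use assms(1) in simp)

lemma valid_sorted_run:
  assumes "n \<le> length (D i)"
  shows "valid D (map (\<lambda>l. (Sorted i, Some (D i ! l))) [0..<n])"
  using assms
proof (induction n)
  case (Suc n)
  have "sorted_count (map (\<lambda>l. (Sorted i, Some (D i ! l))) [0..<n]) i = n"
    by (simp add: sorted_count_def filter_map o_def)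
  then show ?case
    using Suc by (simp add: Let_def)
qed simp

context adversary
begin

lemma card_cand: "card cand = CARD('m) * d"
proof -
  have "card cand = (\<Sum>i\<in>UNIV. card (set (take d (H i))))"
    unfolding cand_def using H_H
    by (intro card_UN_disjoint) (auto dest!: in_set_takeD)
  also have "\<dots> = (\<Sum>i\<in>(UNIV::'m set). d)"
    using distinct_H d_le by (intro sum.cong) (simp_all add: distinct_card)
  finally show ?thesis by simp
qed

lemma card_other_lists:
  assumes "R \<in> cand"
  shows "card {j. R \<notin> set (H j)} = CARD('m) - 1"
proof -
  obtain i where "R \<in> set (H i)"
    using assms by (auto simp: cand_def dest: in_set_takeD)
  then have "{j. R \<notin> set (H j)} = UNIV - {i}"
    using not_in_other by blast
  then show ?thesis
    by (simp add: card_Diff_singleton)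
qed

lemma cost_ge:
  assumes B: "B \<in> algorithms t (Suc (length W))"
    and t: "monotone_agg t" "strict_agg t" and "0 < d" and c: "0 < cS" "0 < cR"
    and count: "\<And>z w j. admissible z \<Longrightarrow> w \<in> cand \<Longrightarrow>
      sorted_count (final_transcript B (db z w)) j \<le> length W + length (H j)"
    and len: "\<And>z w. admissible z \<Longrightarrow> w \<in> cand \<Longrightarrow> length (final_transcript B (db z w)) \<le> b"
  shows "\<exists>z w. admissible z \<and> w \<in> cand \<and>
    (real CARD('m) * real d - 1) * (cS + (real CARD('m) - 1) * cR) \<le> cost cS cR B (db z w)"
proof -
  obtain z w h Y R0 where zw: "admissible z" "w \<in> cand" and h: "halts_with B (db z w) h Y"
    and R0: "R0 \<in> cand" and full: "\<And>R. R \<in> cand - {R0} \<Longrightarrow> full (fst ` set h) R"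
    using halting_stingy_run[OF _ t \<open>0 < d\<close> count len] B unfolding algorithms_def by blast
  let ?C = "cand - {R0}"
  let ?S = "length (filter (\<lambda>e. \<exists>i. fst e = Sorted i) h)"
  let ?R = "length (filter (\<lambda>e. \<exists>R i. fst e = Random R i) h)"
  have r: "reachable B (db z w) h"
    using h by (simp add: halts_with_def)
  have card_C: "card ?C = CARD('m) * d - 1"
    using R0 by (simp add: card_Diff_singleton card_cand)
  have pos: "0 < CARD('m) * d"
    using \<open>0 < d\<close> by simp
  have "?C \<subseteq> seen h"
  proof
    fix R
    assume R: "R \<in> ?C"
    then have "{j. R \<notin> set (H j)} \<noteq> {}"
      using card_other_lists[of R] two by (metis DiffD1 One_nat_def Suc_1 card.empty diff_is_0_eq not_less_eq_eq order_refl)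
    then obtain j where "Random R j \<in> fst ` set h"
      using full[OF R] unfolding full_def by blast
    then show "R \<in> seen h"
      using B by (intro random_access_seen[OF _ db_in_databases[OF zw(2)] r]) (simp_all add: algorithms_def)
  qed
  then have "card ?C \<le> ?S"
    using card_mono[OF finite_seen] card_seen_le le_trans by blast
  then have S: "real CARD('m) * real d - 1 \<le> real ?S"
    using card_C pos by (simp add: of_nat_diff flip: of_nat_mult)
  have "Sigma ?C (\<lambda>R. {j. R \<notin> set (H j)}) \<subseteq> {(R, j). Random R j \<in> fst ` set h}"
    using full by (auto simp: full_def)
  then have "card (Sigma ?C (\<lambda>R. {j. R \<notin> set (H j)})) \<le> ?R"
    using card_mono[OF finite_random] card_random_le le_trans by blast
  moreover have "card (Sigma ?C (\<lambda>R. {j. R \<notin> set (H j)})) = card ?C * (CARD('m) - 1)"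
    using finite_cand card_other_lists by (subst card_SigmaI) auto
  ultimately have "(CARD('m) * d - 1) * (CARD('m) - 1) \<le> ?R"
    using card_C by simp
  then have "real ((CARD('m) * d - 1) * (CARD('m) - 1)) \<le> real ?R"
    by (simp only: of_nat_le_iff)
  then have R: "(real CARD('m) * real d - 1) * (real CARD('m) - 1) \<le> real ?R"
    using pos two by (simp add: of_nat_diff)
  have "(real CARD('m) * real d - 1) * (cS + (real CARD('m) - 1) * cR) =
      cS * (real CARD('m) * real d - 1) + cR * ((real CARD('m) * real d - 1) * (real CARD('m) - 1))"
    by (simp add: algebra_simps)
  also have "\<dots> \<le> cS * real ?S + cR * real ?R"
    using S R c by (intro add_mono mult_left_mono) auto
  also have "\<dots> = cost cS cR B (db z w)"
    unfolding cost_def final_transcript_eq[OF h] sum_access_cost ..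
  finally show ?thesis
    using zw by blast
qed

lemma cheap_algorithm:
  assumes t: "monotone_agg t" "strict_agg t"
    and ex: "\<And>D :: ('a, 'm) database. D \<in> databases (Suc (length W)) \<Longrightarrow>
      \<exists>Y. top_k_answer t (Suc (length W)) D Y"
    and w: "w \<in> cand"
  shows "\<exists>A \<in> algorithms t (Suc (length W)). cost cS cR A (db z w) =
    real (length W + d) * cS + real (Suc (length W)) * (real CARD('m) - 1) * cR"
proof -
  let ?k = "Suc (length W)"
  obtain i where i: "w \<in> set (take d (H i))"
    using w by (auto simp: cand_def)
  have P: "take (length W + d) (W @ H i) = W @ take d (H i)"
    by simp
  obtain js where js: "set js = UNIV - {i}" "distinct js"
    using finite_distinct_list[of "UNIV - {i}"] by auto
  have len_js: "length js = CARD('m) - 1"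
    using distinct_card[OF js(2)] js(1) by (simp add: card_Diff_singleton)
  define S where "S = map (\<lambda>l. (Sorted i, Some (db z w i ! l)) ::
    ('a, 'm) access \<times> ('a \<times> real) option) [0..<length W + d]"
  define G where "G = map (\<lambda>(R, j). (Random R j, Some (R, 1)) ::
    ('a, 'm) access \<times> ('a \<times> real) option) (List.product (w # W) js)"
  let ?W = "insert w (set W)"
  have S_W: "(Sorted i, Some (R, 1)) \<in> set S" if R: "R \<in> ?W" for R
  proof -
    have "R \<in> set (take (length W + d) (W @ H i))"
      using R i unfolding P by auto
    then obtain n where "n < length (take (length W + d) (W @ H i))"
      "take (length W + d) (W @ H i) ! n = R"
      unfolding in_set_conv_nth by blast
    then have n: "n < length W + d" "n < length W + length (H i)" "(W @ H i) ! n = R"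
      by (simp_all del: take_append)
    then have "db z w i ! n = (R, 1)"
      using db_nth(2)[OF n(2)] by simp
    then show ?thesis
      using n(1) by (force simp: S_def image_iff)
  qed
  have "scripted t ?k (S @ G) ((\<lambda>R. (R, 1)) ` ?W) \<in> algorithms t ?k"
  proof (rule scripted_in_algorithms[OF ex])
    fix D :: "('a, 'm) database"
    assume D: "D \<in> databases ?k" and v: "valid D (S @ G)"
    have in_D: "(R, 1) \<in> set (D i)" if "R \<in> ?W" for R
      using valid_sorted_access[OF v, of i "(R, 1)"] S_W[OF that] by (auto dest: nth_mem)
    show "top_k_answer t ?k D ((\<lambda>R. (R, 1)) ` ?W)"
    proof (rule top_k_answer_full[OF t D])
      show "?W \<subseteq> objects D"
        using in_D by (force simp: objects_def)
      show "card ?W = ?k"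
        using winners(2)[OF w] .
      show "grade D R j = 1" if R: "R \<in> ?W" for R j
      proof (cases "j = i")
        case True
        then show ?thesis
          using in_D[OF R] map_of_database[OF D] by (intro grade_eqI) blast
      next
        case False
        then have "(Random R j, Some (R, 1)) \<in> set (S @ G)"
          using R js(1) by (force simp: G_def)
        then show ?thesis
          by (intro grade_eqI valid_random_access[OF v])
      qed
    qed
  next
    fix n R j
    assume n: "n < length (S @ G)" and R: "fst ((S @ G) ! n) = Random R j"
    have "length S \<le> n"
    proof (rule ccontr)
      assume "\<not> length S \<le> n"
      then show False
        using R by (simp add: nth_append S_def)
    qed
    then have "fst (G ! (n - length S)) = Random R j" "n - length S < length G"
      using R n by (simp_all add: nth_append)
    then have "Random R j \<in> fst ` set G"
      by (metis image_eqI nth_mem)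
    then have "R \<in> ?W"
      by (auto simp: G_def)
    then show "R \<in> seen (take n (S @ G))"
      using S_W[of R] \<open>length S \<le> n\<close> by (auto simp: seen_def)
  qed
  moreover have "valid (db z w) (S @ G)"
    unfolding G_def
  proof (rule valid_append_random)
    have "length W + d \<le> length (db z w i)"
      using d_le[of i] by (simp add: db_def order_def)
    then show "valid (db z w) S"
      unfolding S_def by (rule valid_sorted_run)
    show "map_of (db z w j) R = Some 1" if "(R, j) \<in> set (List.product (w # W) js)" for R j
      using that winners(1)[OF w] w by (auto simp: map_of_db gr_def)
  qed
  note scripted_cost[OF this]
  moreover have "(\<Sum>e\<leftarrow>S @ G. access_cost cS cR (fst e)) =
      real (length W + d) * cS + real ?k * (real CARD('m) - 1) * cR"
  proof -
    have "(\<Sum>e\<leftarrow>S. access_cost cS cR (fst e)) = real (length W + d) * cS"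
      by (simp add: S_def o_def sum_list_triv)
    moreover have "(\<Sum>e\<leftarrow>G. access_cost cS cR (fst e)) = real (length (List.product (w # W) js)) * cR"
      unfolding G_def by (simp add: o_def case_prod_unfold sum_list_triv del: product.simps)
    moreover have "length (List.product (w # W) js) = Suc (length W) * (CARD('m) - 1)"
      unfolding length_product len_js by simp
    then have "real (length (List.product (w # W) js)) = real (Suc (length W)) * (real CARD('m) - 1)"
      using two by (simp only: of_nat_mult of_nat_diff) simp
    ultimately show ?thesis
      by (simp only: map_append sum_list_append)
  qed
  ultimately show ?thesis
    by metis
qed

end

lemma adversary_exists:
  assumes "2 \<le> CARD('m::finite)" and "d \<le> n"
  shows "\<exists>(W :: 'a::infinite list) (H :: 'm \<Rightarrow> 'a list).
    adversary W H d \<and> length W = l \<and> (\<forall>i. length (H i) = n)"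
proof -
  obtain g :: "nat \<Rightarrow> 'a" where "inj g"
    using infinite_countable_subset[OF infinite_UNIV] by blast
  define e where "e = g \<circ> (to_nat :: nat + 'm \<times> nat \<Rightarrow> nat)"
  have e: "e x = e y \<longleftrightarrow> x = y" for x y
    using \<open>inj g\<close> by (simp add: e_def inj_eq)
  have "adversary (map (e \<circ> Inl) [0..<l]) (\<lambda>i. map (\<lambda>n. e (Inr (i, n))) [0..<n]) d"
    using assms by unfold_locales (auto simp: distinct_map inj_on_def e)
  then show ?thesis
    by (intro exI conjI) auto
qed

lemma instance_optimal_bound:
  fixes t :: "('m::finite \<Rightarrow> real) \<Rightarrow> real" and B :: "('a::infinite, 'm) algorithm"
  assumes two: "2 \<le> CARD('m)" and c: "0 < cS" "0 < cR" and t: "monotone_agg t" "strict_agg t"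
    and B: "B \<in> algorithms t (Suc l)" and "0 < d"
    and opt: "\<And>A D. A \<in> algorithms t (Suc l) \<Longrightarrow> D \<in> databases (Suc l) \<Longrightarrow>
      cost cS cR B D \<le> r * cost cS cR A D + r'"
  shows "(real CARD('m) * real d - 1) * (cS + (real CARD('m) - 1) * cR) \<le>
    r * (real (l + d) * cS + real (Suc l) * (real CARD('m) - 1) * cR) + r'" (is "_ \<le> ?K")
proof -
  define n where "n = max d (nat \<lceil>?K / cS\<rceil>)"
  obtain W :: "'a list" and H :: "'m \<Rightarrow> 'a list"
    where adv: "adversary W H d" and W: "length W = l" and H: "\<And>i. length (H i) = n"
    using adversary_exists[OF two, of d n l] by (auto simp: n_def)
  interpret adversary W H d
    by (rule adv)
  have ex: "\<exists>Y. top_k_answer t (Suc (length W)) D Y" if "D \<in> databases (Suc (length W))"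
    for D :: "('a, 'm) database"
    using B that by (auto simp: algorithms_def correct_def W)
  have K: "cost cS cR B (db z w) \<le> ?K" if w: "w \<in> cand" for z w
  proof -
    obtain A where "A \<in> algorithms t (Suc l)" "cost cS cR A (db z w) =
        real (l + d) * cS + real (Suc l) * (real CARD('m) - 1) * cR"
      using cheap_algorithm[OF t ex w] unfolding W by blast
    then show ?thesis
      using opt[of A "db z w"] db_in_databases[OF w] by (simp add: W)
  qed
  have count: "sorted_count (final_transcript B (db z w)) j \<le> length W + length (H j)"
    if w: "w \<in> cand" for z w j
  proof -
    have "cS * real (sorted_count (final_transcript B (db z w)) j) \<le> ?K"
      using sorted_count_cost[of cS cR "final_transcript B (db z w)" j] K[OF w, of z] c
      unfolding cost_def by linarith
    then have "real (sorted_count (final_transcript B (db z w)) j) \<le> ?K / cS"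
      using c(1) by (simp add: pos_le_divide_eq mult.commute)
    then have "sorted_count (final_transcript B (db z w)) j \<le> n"
      unfolding n_def by linarith
    then show ?thesis
      by (simp add: H)
  qed
  have len: "length (final_transcript B (db z w)) \<le> nat \<lceil>?K / min cS cR\<rceil>"
    if w: "w \<in> cand" for z w
  proof -
    have "min cS cR * real (length (final_transcript B (db z w))) \<le> ?K"
      using length_cost[of cS cR "final_transcript B (db z w)"] K[OF w, of z]
      unfolding cost_def by linarith
    then have "real (length (final_transcript B (db z w))) \<le> ?K / min cS cR"
      using c by (simp add: pos_le_divide_eq mult.commute)
    then show ?thesis
      by linarith
  qed
  obtain z w where "w \<in> cand" "(real CARD('m) * real d - 1) * (cS + (real CARD('m) - 1) * cR) \<le>
      cost cS cR B (db z w)"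
    using cost_ge[OF _ t \<open>0 < d\<close> c count len] B unfolding W by blast
  then show ?thesis
    using K by (meson order_trans)
qed

theorem theorem9p1:
  fixes t :: "('m::finite \<Rightarrow> real) \<Rightarrow> real"
    and k :: nat
    and cS cR :: real
  assumes "2 \<le> CARD('m)"
    and "1 \<le> k"
    and "0 < cS" and "0 < cR"
    and "aggregation_function t"
    and "monotone_agg t"
    and "strict_agg t"
  shows "\<not> (\<exists>(B :: ('a::infinite, 'm) algorithm) c.
            c < real CARD('m) + real CARD('m) * (real CARD('m) - 1) * cR / cS \<and>
            instance_optimal cS cR (algorithms t k) (databases k) c B)"
proof
  assume "\<exists>(B :: ('a, 'm) algorithm) c.
            c < real CARD('m) + real CARD('m) * (real CARD('m) - 1) * cR / cS \<and>
            instance_optimal cS cR (algorithms t k) (databases k) c B"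
  then obtain B :: "('a, 'm) algorithm" and c c' where
    c: "c < real CARD('m) + real CARD('m) * (real CARD('m) - 1) * cR / cS"
    and B: "B \<in> algorithms t k"
    and opt: "\<And>A D. A \<in> algorithms t k \<Longrightarrow> D \<in> databases k \<Longrightarrow>
      cost cS cR B D \<le> c * cost cS cR A D + c'"
    unfolding instance_optimal_def by blast
  obtain l where k: "k = Suc l"
    using \<open>1 \<le> k\<close> by (cases k) auto
  define m where "m = real CARD('m)"
  define \<alpha> where "\<alpha> = m * (cS + (m - 1) * cR) - c * cS"
  define \<beta> where "\<beta> = c * (real l * cS + real (Suc l) * (m - 1) * cR) + c' + (cS + (m - 1) * cR)"
  have "c * cS < (m + m * (m - 1) * cR / cS) * cS"
    using c \<open>0 < cS\<close> by (simp add: m_def)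
  also have "\<dots> = m * (cS + (m - 1) * cR)"
    using \<open>0 < cS\<close> by (simp add: distrib_left distrib_right)
  finally have "0 < \<alpha>"
    by (simp add: \<alpha>_def)
  have bound: "real d * \<alpha> \<le> \<beta>" if "0 < d" for d
    using instance_optimal_bound[OF assms(1,3,4,6,7) B[unfolded k] that opt[unfolded k]]
    by (simp add: \<alpha>_def \<beta>_def flip: m_def) (simp add: algebra_simps)
  obtain n where "\<beta> < real n * \<alpha>"
    using reals_Archimedean3[OF \<open>0 < \<alpha>\<close>] by blast
  also have "\<dots> \<le> real (Suc n) * \<alpha>"
    using \<open>0 < \<alpha>\<close> by simp
  finally show False
    using bound[of "Suc n"] by simp
qed

end
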